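(* Let $K=\mathbb Q(\eta_0)$ and $$S_{13}=\frac1{\sqrt{13}}\begin{pmatrix}\gamma&\beta\\ \alpha&-\gamma\end{pmatrix}.$$ Then $K$ is a cyclic cubic extension of $\mathbb Q$; all entries of $\sqrt{13}\,S_{13}$ lie in $K$, so that the projective transformation induced by $S_{13}$ is defined over $K$ (it is represented by a matrix in $\mathrm{GL}_2(K)$); no nonzero entry of $S_{13}$ lies in $K$; all entries of $S_{13}$ lie in $K(\sqrt{13})$; and $K(\sqrt{13})=\mathbb Q(\zeta)^+$, the maximal real subfield of $\mathbb Q(\zeta)$.
   Context: Let $\zeta=e^{2\pi i/13}$ and let $C_0=\{\pm1,\pm5\}$, $C_1=\{\pm2,\pm3\}$, $C_2=\{\pm4,\pm6\}$ be sets of residue classes modulo 13 (the cubic residues modulo 13 and their two cosets). Define $$\eta_j=\sum_{a\in C_j}\zeta^a\ (j=0,1,2),\qquad \alpha=\eta_1-\eta_2,\quad \beta=\eta_0-\eta_2,\quad \gamma=\eta_1-\eta_0.$$ All fields are subfields of $\mathbb C$. *)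

theory Defs
  imports "HOL-Analysis.Analysis" "HOL-Algebra.Algebra" "HOL-Algebra.Algebraic_Closure_Type"
begin

section \<open>Subfields of the complex numbers\<close>

text \<open>The field of complex numbers as a \<open>HOL-Algebra\<close> ring; its subfields are the sets
  \<open>L\<close> with \<open>subfield L CC\<close>.\<close>

abbreviation CC :: "complex ring" where
  "CC \<equiv> ring_of_type_algebra"

definition adjoin :: "complex set \<Rightarrow> complex set \<Rightarrow> complex set" where
  "adjoin F S = generate_field CC (F \<union> S)"

text \<open>As in \<^const>\<open>AutoGroup\<close>, automorphisms of \<open>L\<close> are extensional, that is,
  \<open>undefined\<close> outside \<open>L\<close>, so that each automorphism is counted once.\<close>

definition Gal :: "complex set \<Rightarrow> complex set \<Rightarrow> (complex \<Rightarrow> complex) monoid" where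
  "Gal F L = BijGroup L \<lparr>carrier :=
     {\<sigma> \<in> Bij L. \<sigma> \<in> ring_hom (CC \<lparr>carrier := L\<rparr>) (CC \<lparr>carrier := L\<rparr>)
                \<and> (\<forall>x\<in>F. \<sigma> x = x)}\<rparr>"

definition field_extension :: "complex set \<Rightarrow> complex set \<Rightarrow> bool" where
  "field_extension F L \<longleftrightarrow> subfield F CC \<and> subfield L CC \<and> F \<subseteq> L"

definition finite_galois_extension :: "complex set \<Rightarrow> complex set \<Rightarrow> bool" where
  "finite_galois_extension F L \<longleftrightarrow>
     field_extension F L \<and> ring.finite_dimension CC F L \<and>
     {x \<in> L. \<forall>\<sigma>\<in>carrier (Gal F L). \<sigma> x = x} = F"

definition cyclic_extension :: "complex set \<Rightarrow> complex set \<Rightarrow> bool" where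
  "cyclic_extension F L \<longleftrightarrow> finite_galois_extension F L \<and> cyclic_group (Gal F L)"

definition cyclic_cubic_extension :: "complex set \<Rightarrow> complex set \<Rightarrow> bool" where
  "cyclic_cubic_extension F L \<longleftrightarrow> cyclic_extension F L \<and> ring.dimension CC 3 F L"

definition maximal_real_subfield :: "complex set \<Rightarrow> complex set" where
  "maximal_real_subfield L = (GREATEST M. subfield M CC \<and> M \<subseteq> L \<and> M \<subseteq> \<real>)"

lemma field_CC: "Ring.field CC" by (rule field_from_type_algebra)
lemma CC_simps: "carrier CC = UNIV" "x \<otimes>\<^bsub>CC\<^esub> y = x * y" "x \<oplus>\<^bsub>CC\<^esub> y = x + y" "\<one>\<^bsub>CC\<^esub> = 1" "\<zero>\<^bsub>CC\<^esub> = 0" 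
  by (simp_all add: ring_of_type_algebra_def)
lemma CC_neg: "\<ominus>\<^bsub>CC\<^esub> x = - x"
proof -
  interpret Ring.field CC by (rule field_CC)
  show ?thesis by (rule sum_zero_eq_neg[symmetric]) (auto simp: CC_simps)
qed
lemma CC_inv: "x \<noteq> 0 \<Longrightarrow> inv\<^bsub>CC\<^esub> x = inverse x"
proof -
  interpret Ring.field CC by (rule field_CC)
  assume "x \<noteq> 0" thus ?thesis by (intro inv_unique'[symmetric]) (auto simp: CC_simps)
qed

lemma maximal_real_subfield_eq:
  assumes "subfield L CC"
  shows "maximal_real_subfield L = L \<inter> \<real>"
proof -
  interpret Ring.field CC by (rule field_CC)
  have "subfield (L \<inter> \<real>) CC"
  proof (rule subfieldI')
    show "subring (L \<inter> \<real>) CC"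
      using subringE(3,5,6,7)[OF subfieldE(1)[OF assms]]
      by (intro subringI) (simp_all add: CC_simps CC_neg)
  next
    fix k assume "k \<in> L \<inter> \<real> - {\<zero>\<^bsub>CC\<^esub>}"
    hence k: "k \<in> L" "k \<in> \<real>" "k \<noteq> 0"
      by (simp_all add: CC_simps)
    hence "inv\<^bsub>CC\<^esub> k \<in> L"
      using subfield_m_inv(1)[OF assms, of k] by (simp add: CC_simps)
    with k show "inv\<^bsub>CC\<^esub> k \<in> L \<inter> \<real>"
      by (simp add: CC_inv)
  qed
  thus ?thesis unfolding maximal_real_subfield_def
    by (intro Greatest_equality) auto
qed
section \<open>Projective transformations of the complex projective line\<close>

definition GL2 :: "complex set \<Rightarrow> (complex^2^2) set" where
  "GL2 F = {M. (\<forall>i j. M $ i $ j \<in> F) \<and>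
               (\<exists>N. (\<forall>i j. N $ i $ j \<in> F) \<and> M ** N = mat 1 \<and> N ** M = mat 1)}"

text \<open>Points of the projective line are the lines through the origin in \<open>\<complex>\<^sup>2\<close>; here
  \<^const>\<open>vec.span\<close> is the span over the field of scalars \<open>\<complex>\<close>.\<close>

definition projective_line :: "(complex^2) set set" where
  "projective_line = {vec.span {v} | v. v \<noteq> 0}"

definition projective_map :: "complex^2^2 \<Rightarrow> (complex^2) set \<Rightarrow> (complex^2) set" where
  "projective_map A = (\<lambda>P\<in>projective_line. (\<lambda>v. A *v v) ` P)"

text \<open>\<open>invertible A\<close> is what makes \<open>projective_map A\<close> a projective transformation.\<close>

definition projective_map_defined_over :: "complex^2^2 \<Rightarrow> complex set \<Rightarrow> bool" where
  "projective_map_defined_over A F \<longleftrightarrow>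
     invertible A \<and> (\<exists>M\<in>GL2 F. projective_map M = projective_map A)"

section \<open>Cubic Gaussian periods modulo 13\<close>

definition zeta :: complex where
  "zeta = exp (2 * complex_of_real pi * \<i> / 13)"

text \<open>Residue classes modulo 13 are given by integer representatives: \<open>zeta\<close> is a 13th root of
  unity, so \<open>zeta powi a\<close> depends only on the class of \<open>a\<close>.\<close>

definition C0 :: "int set" where "C0 = {1, -1, 5, -5}"
definition C1 :: "int set" where "C1 = {2, -2, 3, -3}"
definition C2 :: "int set" where "C2 = {4, -4, 6, -6}"

definition eta0 :: complex where "eta0 = (\<Sum>a\<in>C0. zeta powi a)"
definition eta1 :: complex where "eta1 = (\<Sum>a\<in>C1. zeta powi a)"
definition eta2 :: complex where "eta2 = (\<Sum>a\<in>C2. zeta powi a)"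

definition alpha :: complex where "alpha = eta1 - eta2"
definition beta :: complex where "beta = eta0 - eta2"
definition gamma :: complex where "gamma = eta1 - eta0"

definition S13 :: "complex^2^2" where
  "S13 = (1 / sqrt 13) *\<^sub>R vector [vector [gamma, beta], vector [alpha, - gamma]]"

definition K13 :: "complex set" where
  "K13 = adjoin \<rat> {eta0}"

end

theory Submission
  imports Defs
begin

text \<open>The whole theorem rests on the multiplication table of the three periods,
  \<open>eta0 * eta1 = eta1 - 1\<close> and \<open>eta0\<^sup>2 = 4 + eta1 + 2 * eta2\<close> together with their cyclic
  permutations, and on \<open>eta0 + eta1 + eta2 = -1\<close>. By the table the rational combinations of the
  periods form a ring on which the cyclic shift \<open>eta0 \<rightarrow> eta1 \<rightarrow> eta2 \<rightarrow> eta0\<close> acts by ring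
  automorphisms, once it is known that the periods are linearly independent over the rationals.

  Independence and the existence of inverses come from one source: the product of the three shifts of
  \<open>a * eta0 + b * eta1 + c * eta2\<close> is a rational number given by an integral cubic form in
  \<open>a\<close>, \<open>b\<close>, \<open>c\<close> (\<open>period_comb_norm\<close>). Since 2 is inert in the cubic field, this form takes an even
  value at integers only if all three are even (\<open>norm_form_even_int\<close>), so a descent shows that it has no
  nontrivial rational zero. Hence \<open>K13\<close> is the set of rational combinations of the periods and has degree
  three. An automorphism is determined by the image of \<open>eta0\<close>, which is one of the three periods, so the
  Galois group is generated by the shift (\<open>Gal_K13_cases\<close>), whose fixed elements have equal coordinates and
  are rational.

  The square root of 13 is not in \<open>K13\<close>: the shift could only send it to plus or minus itself, and having
  order three it would have to fix it. So division by it carries the nonzero elements of \<open>K13\<close> out of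
  \<open>K13\<close>, which gives the claim on the entries of \<open>S13\<close>; rescaling by it does not change the projective
  transformation, and the rescaled matrix is invertible over \<open>K13\<close> because its square is 13 times the
  identity.

  Finally, the quadratic Gauss sum puts the square root of 13 into \<open>\<rat>(zeta)\<close>. Multiplying it by the
  difference of the two halves of \<open>eta0\<close> gives an element of \<open>K13\<close>, so that both halves, in
  particular \<open>zeta + inverse zeta\<close>, lie in the real field obtained by adjoining the square root to
  \<open>K13\<close>. Over that field \<open>zeta\<close> is quadratic (\<open>subfield_L13_zeta\<close>), and as it is not real, a real
  element \<open>a + b * zeta\<close> has \<open>b = 0\<close>.\<close>

section \<open>Subfields of the complex numbers\<close>

lemma subfield_CC_I:
  assumes "1 \<in> F"
    and "\<And>x y. x \<in> F \<Longrightarrow> y \<in> F \<Longrightarrow> x + y \<in> F"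
    and "\<And>x. x \<in> F \<Longrightarrow> - x \<in> F"
    and "\<And>x y. x \<in> F \<Longrightarrow> y \<in> F \<Longrightarrow> x * y \<in> F"
    and "\<And>x. x \<in> F \<Longrightarrow> x \<noteq> 0 \<Longrightarrow> inverse x \<in> F"
  shows "subfield F CC"
proof -
  interpret Ring.field CC by (rule field_CC)
  show ?thesis
  proof (rule subfieldI')
    show "subring F CC"
      using assms by (intro subringI) (simp_all add: CC_simps CC_neg)
  next
    fix k assume "k \<in> F - {\<zero>\<^bsub>CC\<^esub>}"
    then show "inv\<^bsub>CC\<^esub> k \<in> F"
      using assms(5)[of k] by (simp add: CC_inv CC_simps)
  qed
qed

lemma subfield_CC_closed:
  assumes F: "subfield F CC"
  shows "0 \<in> F" "1 \<in> F"
    and "x \<in> F \<Longrightarrow> y \<in> F \<Longrightarrow> x + y \<in> F"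
    and "x \<in> F \<Longrightarrow> - x \<in> F"
    and "x \<in> F \<Longrightarrow> y \<in> F \<Longrightarrow> x - y \<in> F"
    and "x \<in> F \<Longrightarrow> y \<in> F \<Longrightarrow> x * y \<in> F"
    and "x \<in> F \<Longrightarrow> inverse x \<in> F"
    and "x \<in> F \<Longrightarrow> y \<in> F \<Longrightarrow> x / y \<in> F"
proof -
  interpret Ring.field CC by (rule field_CC)
  note R = subringE[OF subfieldE(1)[OF F]]
  show z: "0 \<in> F" and "1 \<in> F"
    using R(2,3) by (simp_all add: CC_simps)
  show add: "x + y \<in> F" if "x \<in> F" "y \<in> F" for x y
    using R(7)[OF that] by (simp add: CC_simps)
  show neg: "- x \<in> F" if "x \<in> F" for x
    using R(5)[OF that] by (simp add: CC_neg)
  show mul: "x * y \<in> F" if "x \<in> F" "y \<in> F" for x y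
    using R(6)[OF that] by (simp add: CC_simps)
  show "x - y \<in> F" if "x \<in> F" "y \<in> F" for x y
    using add[OF that(1) neg[OF that(2)]] by simp
  show inv: "inverse x \<in> F" if "x \<in> F" for x
    using subfield_m_inv(1)[OF F, of x] that z
    by (cases "x = 0") (simp_all add: CC_inv CC_simps)
  show "x / y \<in> F" if "x \<in> F" "y \<in> F" for x y
    using mul[OF that(1) inv[OF that(2)]] by (simp add: field_simps)
qed

lemma subfield_CC_power:
  assumes "subfield F CC" "x \<in> F"
  shows "x ^ n \<in> F"
  by (induction n) (auto intro: subfield_CC_closed[OF assms(1)] assms(2))

lemma subfield_CC_powi:
  assumes "subfield F CC" "x \<in> F"
  shows "x powi n \<in> F"
  by (auto simp: power_int_def intro: subfield_CC_power[OF assms(1)] subfield_CC_closed[OF assms(1)] assms(2))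

lemma Rats_subset_subfield_CC:
  assumes "subfield F CC"
  shows "\<rat> \<subseteq> F"
proof
  note cl = subfield_CC_closed[OF assms]
  fix x :: complex assume "x \<in> \<rat>"
  then obtain a b where x: "x = of_int a / of_int b" by (auto elim: Rats_cases')
  have nat: "of_nat n \<in> F" for n
    by (induction n) (auto intro: cl)
  have "of_int k \<in> F" for k
    using nat cl(4) by (cases k) (auto simp del: of_nat_Suc)
  then show "x \<in> F" unfolding x by (intro cl)
qed

lemma subfield_CC_of_rat: "subfield F CC \<Longrightarrow> of_rat r \<in> F"
  using Rats_subset_subfield_CC by (auto simp: subset_iff)

lemma subfield_CC_numeral: "subfield F CC \<Longrightarrow> numeral n \<in> F"
  using Rats_subset_subfield_CC by (auto simp: subset_iff)

lemma subfield_Rats: "subfield \<rat> CC"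
  by (rule subfield_CC_I) auto

lemma subfield_Reals: "subfield \<real> CC"
  by (rule subfield_CC_I) auto

lemma
  shows subfield_adjoin: "subfield (adjoin F S) CC"
    and adjoin_base: "F \<subseteq> adjoin F S"
    and adjoin_gens: "S \<subseteq> adjoin F S"
    and adjoin_least: "subfield E CC \<Longrightarrow> F \<subseteq> E \<Longrightarrow> S \<subseteq> E \<Longrightarrow> adjoin F S \<subseteq> E"
proof -
  interpret Ring.field CC by (rule field_CC)
  show "subfield (adjoin F S) CC"
    unfolding adjoin_def by (rule generate_field_is_subfield) (simp add: CC_simps)
  show "F \<subseteq> adjoin F S" "S \<subseteq> adjoin F S"
    unfolding adjoin_def by (auto intro: generate_field.incl)
  show "adjoin F S \<subseteq> E" if "subfield E CC" "F \<subseteq> E" "S \<subseteq> E"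
    unfolding adjoin_def by (rule generate_field_min_subfield1) (use that in \<open>auto simp: CC_simps\<close>)
qed

section \<open>Real sums of thirteenth roots of unity\<close>

text \<open>The conjugates of \<open>zeta\<close> over the real subfield are \<open>zeta\<close> and its inverse; this is the trace of
  \<open>zeta powi k\<close>. Each period is a sum of two such traces, and traces multiply by the rule
  \<open>zeta_tr_mult\<close> for cosines, so all products below reduce to the six traces \<open>zeta_tr 1\<close>, \<dots>,
  \<open>zeta_tr 6\<close>.\<close>

definition zeta_tr :: "int \<Rightarrow> complex" where
  "zeta_tr k = zeta powi k + zeta powi (- k)"

lemma zeta_cis: "zeta = cis (2 * pi / 13)"
  by (simp add: zeta_def cis_conv_exp mult_ac)

lemma zeta_nonzero [simp]: "zeta \<noteq> 0"
  by (simp add: zeta_cis)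

lemma zeta_pow_13: "zeta ^ 13 = 1"
proof -
  have "zeta ^ 13 = cis (real 13 * (2 * pi / 13))"
    by (simp only: zeta_cis Complex.DeMoivre)
  then show ?thesis by simp
qed

lemma Im_zeta: "Im zeta > 0"
  by (simp add: zeta_cis sin_gt_zero)

lemma cnj_zeta: "cnj zeta = inverse zeta"
  by (simp add: zeta_cis cis_cnj cis_inverse)

lemma zeta_tr_mult: "zeta_tr a * zeta_tr b = zeta_tr (a + b) + zeta_tr (a - b)"
  by (simp add: zeta_tr_def power_int_add power_int_diff power_int_minus divide_inverse algebra_simps)

lemma zeta_tr_minus [simp]: "zeta_tr (- k) = zeta_tr k"
  by (simp add: zeta_tr_def)

lemma zeta_tr_reflect: "zeta_tr (13 - k) = zeta_tr k"
proof -
  have z: "zeta powi 13 = 1"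
    using zeta_pow_13 by simp
  have "zeta powi (13 - k) = zeta powi (- k)" "zeta powi (k - 13) = zeta powi k"
    using z by (simp_all add: power_int_diff power_int_minus field_simps)
  then show ?thesis by (simp add: zeta_tr_def)
qed

lemma zeta_tr_reduce:
  "zeta_tr 0 = 2" "zeta_tr 7 = zeta_tr 6" "zeta_tr 8 = zeta_tr 5"
  "zeta_tr 9 = zeta_tr 4" "zeta_tr 10 = zeta_tr 3" "zeta_tr 11 = zeta_tr 2" "zeta_tr 12 = zeta_tr 1"
  using zeta_tr_reflect[of 6] zeta_tr_reflect[of 5] zeta_tr_reflect[of 4]
    zeta_tr_reflect[of 3] zeta_tr_reflect[of 2] zeta_tr_reflect[of 1]
  by (simp_all add: zeta_tr_def)

lemma zeta_tr_sum: "zeta_tr 1 + zeta_tr 2 + zeta_tr 3 + zeta_tr 4 + zeta_tr 5 + zeta_tr 6 = -1"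
proof -
  have "zeta \<noteq> 1"
    using Im_zeta by auto
  then have "(\<Sum>k<13. zeta ^ k) = 0"
    by (simp add: geometric_sum zeta_pow_13)
  moreover have "zeta powi (- int k) = zeta ^ (13 - k)" if "k \<le> 13" for k
    using that zeta_pow_13 by (simp add: power_int_minus power_diff field_simps)
  from this[of 1] this[of 2] this[of 3] this[of 4] this[of 5] this[of 6]
  have "zeta_tr 1 + zeta_tr 2 + zeta_tr 3 + zeta_tr 4 + zeta_tr 5 + zeta_tr 6 = (\<Sum>k<13. zeta ^ k) - 1"
    by (simp add: zeta_tr_def lessThan_nat_numeral)
  ultimately show ?thesis by simp
qed

lemma eta_zeta_tr:
  "eta0 = zeta_tr 1 + zeta_tr 5" "eta1 = zeta_tr 2 + zeta_tr 3" "eta2 = zeta_tr 4 + zeta_tr 6"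
  by (simp_all add: eta0_def eta1_def eta2_def C0_def C1_def C2_def zeta_tr_def)

lemma eta_sum: "eta0 + eta1 + eta2 = -1"
  using zeta_tr_sum by (simp add: eta_zeta_tr algebra_simps)

lemma eta_mult:
  "eta0 * eta1 = eta1 - 1" "eta1 * eta2 = eta2 - 1" "eta2 * eta0 = eta0 - 1"
proof -
  have w1: "zeta_tr 1 = -1 - zeta_tr 2 - zeta_tr 3 - zeta_tr 4 - zeta_tr 5 - zeta_tr 6"
    using zeta_tr_sum by (simp add: algebra_simps)
  show "eta0 * eta1 = eta1 - 1" "eta1 * eta2 = eta2 - 1" "eta2 * eta0 = eta0 - 1"
    by (simp_all add: eta_zeta_tr distrib_left distrib_right zeta_tr_mult zeta_tr_reduce) (simp_all add: w1)
qed

lemma eta_square: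
  "eta0\<^sup>2 = 4 + eta1 + 2 * eta2" "eta1\<^sup>2 = 4 + eta2 + 2 * eta0" "eta2\<^sup>2 = 4 + eta0 + 2 * eta1"
  by (simp_all add: eta_zeta_tr distrib_left distrib_right zeta_tr_mult zeta_tr_reduce power2_eq_square)

text \<open>This is the quadratic Gauss sum modulo 13, with the nonzero residues grouped in pairs \<open>\<plusminus> k\<close>: the
  quadratic residues are \<open>\<plusminus> 1\<close>, \<open>\<plusminus> 3\<close> and \<open>\<plusminus> 4\<close>.\<close>

definition gauss_sum :: complex where
  "gauss_sum = zeta_tr 1 + zeta_tr 3 + zeta_tr 4 - zeta_tr 2 - zeta_tr 5 - zeta_tr 6"

lemma gauss_sum_square: "gauss_sum\<^sup>2 = 13"
proof -
  have w1: "zeta_tr 1 = -1 - zeta_tr 2 - zeta_tr 3 - zeta_tr 4 - zeta_tr 5 - zeta_tr 6"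
    using zeta_tr_sum by (simp add: algebra_simps)
  show ?thesis
    by (simp add: gauss_sum_def algebra_simps zeta_tr_mult zeta_tr_reduce power2_eq_square) (simp add: w1)
qed

text \<open>Multiplication of exponents by 5 exchanges residues and nonresidues and preserves each period. Hence
  it changes the sign of both factors on the left and fixes their product, which is therefore a
  combination of periods.\<close>

lemma gauss_sum_mult_diff:
  "gauss_sum * (zeta_tr 1 - zeta_tr 5) = 4 - eta0 + 2 * eta1 - 2 * eta2"
  by (simp add: gauss_sum_def eta_zeta_tr algebra_simps zeta_tr_mult zeta_tr_reduce)

lemma gauss_sum_cases:
  "gauss_sum = complex_of_real (sqrt 13) \<or> gauss_sum = - complex_of_real (sqrt 13)"
proof -
  have "(complex_of_real (sqrt 13))\<^sup>2 = 13"
    by (simp flip: of_real_power)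
  then show ?thesis
    using gauss_sum_square by (metis power2_eq_iff)
qed

section \<open>The cubic field of periods\<close>

definition period_comb :: "rat \<Rightarrow> rat \<Rightarrow> rat \<Rightarrow> complex" where
  "period_comb a b c = of_rat a * eta0 + of_rat b * eta1 + of_rat c * eta2"

text \<open>The coordinate of \<open>eta0\<close> in a product of two combinations of periods. The table of products is
  invariant under cyclic permutation of the periods, so the other two coordinates are the same function
  of the permuted arguments.\<close>

definition period_mult_coeff :: "rat \<Rightarrow> rat \<Rightarrow> rat \<Rightarrow> rat \<Rightarrow> rat \<Rightarrow> rat \<Rightarrow> rat" where
  "period_mult_coeff a b c a' b' c' =
     - 4 * a * a' - 2 * b * b' - 3 * c * c'
     + (a * b' + b * a') + (b * c' + c * b') + 2 * (c * a' + a * c')"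

text \<open>The norm form of the cubic field with respect to the basis \<open>eta0\<close>, \<open>eta1\<close>, \<open>eta2\<close>. It is polymorphic
  because the descent takes place over the integers.\<close>

definition norm_form :: "'a::comm_ring_1 \<Rightarrow> 'a \<Rightarrow> 'a \<Rightarrow> 'a" where
  "norm_form a b c =
     - (a ^ 3 + b ^ 3 + c ^ 3) - 3 * (a\<^sup>2 * b + b\<^sup>2 * c + c\<^sup>2 * a)
     + 10 * (a\<^sup>2 * c + b\<^sup>2 * a + c\<^sup>2 * b) - 19 * (a * b * c)"

lemma period_comb_mult:
  "period_comb a b c * period_comb a' b' c' =
     period_comb (period_mult_coeff a b c a' b' c') (period_mult_coeff b c a b' c' a')
         (period_mult_coeff c a b c' a' b')"
proof -
  note of_rat = of_rat_add of_rat_mult of_rat_diff of_rat_minus of_rat_numeral_eq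
  have "(x * eta0 + y * eta1 + z * eta2) * (x' * eta0 + y' * eta1 + z' * eta2) =
      (- 4 * x * x' - 2 * y * y' - 3 * z * z' + (x * y' + y * x') + (y * z' + z * y')
        + 2 * (z * x' + x * z')) * eta0
    + (- 4 * y * y' - 2 * z * z' - 3 * x * x' + (y * z' + z * y') + (z * x' + x * z')
        + 2 * (x * y' + y * x')) * eta1
    + (- 4 * z * z' - 2 * x * x' - 3 * y * y' + (z * x' + x * z') + (x * y' + y * x')
        + 2 * (y * z' + z * y')) * eta2" for x y z x' y' z' :: complex
  proof -
    (* Written homogeneously in the periods, the constants 4 and -1 of the table are distributed
       over the basis by means of eta0 + eta1 + eta2 = -1. *)
    have e0: "eta0 = - 1 - eta1 - eta2"
      using eta_sum by (simp add: algebra_simps)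
    have sq: "eta0\<^sup>2 = - 4 * eta0 - 3 * eta1 - 2 * eta2"
      "eta1\<^sup>2 = - 4 * eta1 - 3 * eta2 - 2 * eta0" "eta2\<^sup>2 = - 4 * eta2 - 3 * eta0 - 2 * eta1"
      unfolding eta_square by (simp_all add: e0)
    have mult: "eta0 * eta1 = eta0 + 2 * eta1 + eta2" "eta1 * eta2 = eta1 + 2 * eta2 + eta0"
      "eta2 * eta0 = eta2 + 2 * eta0 + eta1"
      unfolding eta_mult by (simp_all add: e0)
    have "(x * eta0 + y * eta1 + z * eta2) * (x' * eta0 + y' * eta1 + z' * eta2) =
        x * x' * eta0\<^sup>2 + y * y' * eta1\<^sup>2 + z * z' * eta2\<^sup>2 + (x * y' + y * x') * (eta0 * eta1)
        + (y * z' + z * y') * (eta1 * eta2) + (z * x' + x * z') * (eta2 * eta0)"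
      by (simp add: algebra_simps power2_eq_square)
    then show ?thesis
      unfolding sq mult by (simp add: algebra_simps)
  qed
  from this[of "of_rat a" "of_rat b" "of_rat c" "of_rat a'" "of_rat b'" "of_rat c'"]
  show ?thesis
    by (simp add: period_comb_def period_mult_coeff_def of_rat)
qed

lemma period_comb_add: "period_comb a b c + period_comb a' b' c' = period_comb (a + a') (b + b') (c + c')"
  by (simp add: period_comb_def of_rat_add algebra_simps)

lemma period_comb_minus: "- period_comb a b c = period_comb (- a) (- b) (- c)"
  by (simp add: period_comb_def of_rat_minus algebra_simps)

lemma period_comb_diff: "period_comb a b c - period_comb a' b' c' = period_comb (a - a') (b - b') (c - c')"
  by (simp add: period_comb_def of_rat_diff algebra_simps)

lemma period_comb_diag: "period_comb (- r) (- r) (- r) = of_rat r"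
proof -
  have "period_comb (- r) (- r) (- r) = - of_rat r * (eta0 + eta1 + eta2)"
    by (simp add: period_comb_def of_rat_minus algebra_simps)
  then show ?thesis by (simp add: eta_sum)
qed

lemma period_comb_norm: "period_comb a b c * (period_comb c a b * period_comb b c a) = of_rat (norm_form a b c)"
proof -
  have cong: "period_comb x y z = of_rat r" if "x = - r" "y = - r" "z = - r" for x y z r
    using that period_comb_diag by simp
  show ?thesis
    unfolding period_comb_mult
    by (rule cong)
       (simp_all add: period_mult_coeff_def norm_form_def algebra_simps power2_eq_square power3_eq_cube)
qed

text \<open>Modulo 2 the form is \<open>1 + (1 + a) * (1 + b) * (1 + c)\<close>, which vanishes only at the origin. This reflects
  that 2 stays prime in the cubic field, whose residue field there has eight elements.\<close>

lemma norm_form_even_int: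
  fixes a b c :: int
  assumes "even (norm_form a b c)"
  shows "even a" "even b" "even c"
  using assms by (auto simp: norm_form_def)

lemma norm_form_scale: "norm_form (t * a) (t * b) (t * c) = t ^ 3 * norm_form a b c"
  by (simp add: norm_form_def algebra_simps power2_eq_square power3_eq_cube)

lemma norm_form_of_int:
  "norm_form (of_int a) (of_int b) (of_int c) = of_int (norm_form a b c)"
  by (simp add: norm_form_def)

text \<open>Infinite descent: a zero has even coordinates, and halving them gives a smaller zero.\<close>

lemma norm_form_int_eq_0:
  fixes a b c :: int
  assumes "norm_form a b c = 0"
  shows "a = 0 \<and> b = 0 \<and> c = 0"
  using assms
proof (induction "nat (\<bar>a\<bar> + \<bar>b\<bar> + \<bar>c\<bar>)" arbitrary: a b c rule: less_induct)
  case less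
  have "even (norm_form a b c)" using less.prems by simp
  from norm_form_even_int[OF this] obtain a' b' c' where
    eq: "a = 2 * a'" "b = 2 * b'" "c = 2 * c'"
    by (auto elim!: evenE)
  have "norm_form a' b' c' = 0"
    using less.prems unfolding eq norm_form_scale by simp
  show ?case
  proof (rule ccontr)
    assume "\<not> ?thesis"
    then have "nat (\<bar>a'\<bar> + \<bar>b'\<bar> + \<bar>c'\<bar>) < nat (\<bar>a\<bar> + \<bar>b\<bar> + \<bar>c\<bar>)"
      unfolding eq by auto
    from less.hyps[OF this \<open>norm_form a' b' c' = 0\<close>] \<open>\<not> ?thesis\<close> show False
      by (simp add: eq)
  qed
qed

lemma norm_form_rat_eq_0:
  fixes a b c :: rat
  assumes "norm_form a b c = 0"
  shows "a = 0 \<and> b = 0 \<and> c = 0"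
proof -
  obtain p q r s t u where
    "a = of_int p / of_int q" "b = of_int r / of_int s" "c = of_int t / of_int u"
    and pos: "q > 0" "s > 0" "u > 0"
    by (metis quotient_of_div quotient_of_denom_pos surj_pair)
  then have eq: "of_int (q * s * u) * a = of_int (p * s * u)"
    "of_int (q * s * u) * b = of_int (r * q * u)"
    "of_int (q * s * u) * c = of_int (t * q * s)"
    by (simp_all add: field_simps)
  have "norm_form (of_int (q * s * u) * a) (of_int (q * s * u) * b) (of_int (q * s * u) * c) = 0"
    unfolding norm_form_scale assms by simp
  then have "norm_form (p * s * u) (r * q * u) (t * q * s) = 0"
    unfolding eq norm_form_of_int by simp
  from norm_form_int_eq_0[OF this] have "p = 0 \<and> r = 0 \<and> t = 0"
    using pos by simp
  then show ?thesis
    using eq pos by simp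
qed

lemma period_comb_eq_0: "period_comb a b c = 0 \<Longrightarrow> a = 0 \<and> b = 0 \<and> c = 0"
  using period_comb_norm[of a b c] norm_form_rat_eq_0[of a b c] by simp

lemma period_comb_inject: "period_comb a b c = period_comb a' b' c' \<longleftrightarrow> a = a' \<and> b = b' \<and> c = c'"
  using period_comb_eq_0[of "a - a'" "b - b'" "c - c'"] by (auto simp flip: period_comb_diff)

lemma eta_period_comb: "eta0 = period_comb 1 0 0" "eta1 = period_comb 0 1 0" "eta2 = period_comb 0 0 1"
  by (simp_all add: period_comb_def)

lemma eta1_poly: "eta1 = 2 - 2 * eta0 - eta0\<^sup>2"
  and eta2_poly: "eta2 = eta0\<^sup>2 + eta0 - 3"
proof -
  have e2: "eta2 = - 1 - eta0 - eta1"
    using eta_sum by (simp add: algebra_simps)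
  show "eta1 = 2 - 2 * eta0 - eta0\<^sup>2" "eta2 = eta0\<^sup>2 + eta0 - 3"
    unfolding eta_square by (simp_all add: e2)
qed

text \<open>The inverse of a nonzero element is the product of its other two shifts divided by the norm.\<close>

lemma subfield_range_period_comb: "subfield {period_comb a b c | a b c. True} CC"
proof (rule subfield_CC_I)
  show "1 \<in> {period_comb a b c | a b c. True}"
    using period_comb_diag[of 1] by force
next
  fix x assume "x \<in> {period_comb a b c | a b c. True}" and nz: "x \<noteq> 0"
  then obtain a b c where x: "x = period_comb a b c" by blast
  have N: "norm_form a b c \<noteq> 0"
    using norm_form_rat_eq_0[of a b c] nz by (auto simp: x period_comb_def)
  define y where "y = period_comb c a b * period_comb b c a * of_rat (1 / norm_form a b c)"
  have "x * y = 1"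
    using period_comb_norm[of a b c] N unfolding y_def x
    by (simp add: of_rat_divide field_simps)
  then have "inverse x = y"
    using nz by (metis inverse_unique)
  then show "inverse x \<in> {period_comb a b c | a b c. True}"
    unfolding y_def period_comb_diag[symmetric] period_comb_mult by blast
qed (use period_comb_add period_comb_minus period_comb_mult in blast)+

lemma K13_eq: "K13 = {period_comb a b c | a b c. True}"
proof
  show "K13 \<subseteq> {period_comb a b c | a b c. True}"
    unfolding K13_def
    by (rule adjoin_least[OF subfield_range_period_comb Rats_subset_subfield_CC[OF subfield_range_period_comb]])
       (use eta_period_comb in blast)
  have K: "subfield K13 CC" unfolding K13_def by (rule subfield_adjoin)
  have e0: "eta0 \<in> K13" using adjoin_gens unfolding K13_def by blast
  have "eta1 \<in> K13" "eta2 \<in> K13"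
    unfolding eta1_poly eta2_poly
    by (intro subfield_CC_closed[OF K] subfield_CC_power[OF K] subfield_CC_numeral[OF K] e0)+
  with e0 show "{period_comb a b c | a b c. True} \<subseteq> K13"
    by (auto simp: period_comb_def intro!: subfield_CC_closed[OF K] subfield_CC_of_rat[OF K])
qed

lemma period_comb_in_K13 [simp]: "period_comb a b c \<in> K13"
  unfolding K13_eq by blast

lemma K13_cases:
  assumes "x \<in> K13"
  obtains a b c where "x = period_comb a b c"
  using assms unfolding K13_eq by blast

lemma eta_in_K13: "eta0 \<in> K13" "eta1 \<in> K13" "eta2 \<in> K13"
  unfolding eta_period_comb by simp_all

lemma subfield_K13: "subfield K13 CC"
  unfolding K13_eq by (rule subfield_range_period_comb)

lemma dimension_K13: "ring.dimension CC 3 \<rat> K13"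
proof -
  interpret Ring.field CC by (rule field_CC)
  define E1 where "E1 = line_extension \<rat> eta2 {\<zero>\<^bsub>CC\<^esub>}"
  define E2 where "E2 = line_extension \<rat> eta1 E1"
  define E3 where "E3 = line_extension \<rat> eta0 E2"
  have ext: "line_extension \<rat> a E = {of_rat r * a + v | r v. v \<in> E}" for a E
    unfolding set_eq_iff line_extension_mem_iff CC_simps mem_Collect_eq
    by (metis Rats_cases Rats_of_rat)
  have coords: "of_rat c * eta2 + 0 = period_comb 0 0 c"
    "of_rat b * eta1 + period_comb 0 0 c = period_comb 0 b c"
    "of_rat a * eta0 + period_comb 0 b c = period_comb a b c" for a b c
    by (simp_all add: period_comb_def)
  have E1: "E1 = {period_comb 0 0 c | c. True}"
    unfolding E1_def ext CC_simps set_eq_iff mem_Collect_eq singleton_iff by (metis coords(1))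
  have E2: "E2 = {period_comb 0 b c | b c. True}"
    unfolding E2_def ext E1 set_eq_iff mem_Collect_eq by (metis coords(2))
  have E3: "E3 = {period_comb a b c | a b c. True}"
    unfolding E3_def ext E2 set_eq_iff mem_Collect_eq by (metis coords(3))
  have "dimension (Suc 0) \<rat> E1"
    unfolding E1_def
    by (rule Suc_dim[OF _ _ zero_dim]) (use period_comb_eq_0[of 0 0 1] in \<open>auto simp: CC_simps eta_period_comb\<close>)
  then have "dimension (Suc (Suc 0)) \<rat> E2"
    unfolding E2_def by (intro Suc_dim) (auto simp: CC_simps eta_period_comb E1 period_comb_inject)
  then have "dimension (Suc (Suc (Suc 0))) \<rat> E3"
    unfolding E3_def by (intro Suc_dim) (auto simp: CC_simps eta_period_comb E2 period_comb_inject)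
  then show ?thesis
    unfolding E3 K13_eq by (simp add: numeral_3_eq_3)
qed

section \<open>The Galois group\<close>

text \<open>The description is satisfied by one value because coordinates are unique (\<open>period_comb_inject\<close>); the value
  outside \<open>K13\<close> is that of extensional functions, as required of the elements of the Galois group.\<close>

definition period_shift :: "complex \<Rightarrow> complex" where
  "period_shift = (\<lambda>x\<in>K13. THE y. \<exists>a b c. x = period_comb a b c \<and> y = period_comb c a b)"

lemma period_shift_period_comb [simp]: "period_shift (period_comb a b c) = period_comb c a b"
  unfolding period_shift_def by (auto simp: period_comb_inject)

lemma period_shift_extensional: "period_shift \<in> extensional K13"
  by (simp add: period_shift_def)

lemma period_shift_fixed:
  assumes "x \<in> K13" "period_shift x = x"
  shows "x \<in> \<rat>"
proof -
  obtain a b c where x: "x = period_comb a b c"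
    using assms(1) by (rule K13_cases)
  from assms(2) have "c = a" "a = b"
    unfolding x period_shift_period_comb period_comb_inject by blast+
  with x have "x = period_comb (- (- a)) (- (- a)) (- (- a))"
    by simp
  then show ?thesis
    unfolding period_comb_diag by simp
qed

lemma period_shift_mult:
  assumes "x \<in> K13" "y \<in> K13"
  shows "period_shift (x * y) = period_shift x * period_shift y"
  using assms by (auto elim!: K13_cases simp: period_comb_mult)

lemma sqrt_13_irrational: "sqrt 13 \<notin> \<rat>"
proof
  assume "sqrt 13 \<in> \<rat>"
  then obtain m n :: nat where n: "n \<noteq> 0" and eq: "\<bar>sqrt 13\<bar> = real m / real n"
    and "coprime m n" by (rule Rats_abs_nat_div_natE)
  have "real m = sqrt 13 * real n"
    using eq n by (simp add: field_simps)
  then have "(real m)\<^sup>2 = 13 * (real n)\<^sup>2"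
    by (simp add: power_mult_distrib)
  then have "real (m\<^sup>2) = real (13 * n\<^sup>2)"
    by simp
  then have sq: "m\<^sup>2 = 13 * n\<^sup>2"
    by (simp only: of_nat_eq_iff)
  then have "n\<^sup>2 dvd m\<^sup>2" by simp
  moreover have "coprime (m\<^sup>2) (n\<^sup>2)"
    using \<open>coprime m n\<close> by simp
  ultimately have "n\<^sup>2 = 1"
    using coprime_common_divisor[of "m\<^sup>2" "n\<^sup>2" "n\<^sup>2"] by simp
  with sq have m: "m\<^sup>2 = 13" by simp
  then have "m < 4"
    using power_mono[of 4 m 2] by (cases "m < 4") auto
  then have "m \<in> {0, 1, 2, 3}" by auto
  with m show False by auto
qed

text \<open>The shift would map the square root to plus or minus itself. The minus sign is impossible: it would
  remain after three applications of the shift, which are the identity. In coordinates, it forces each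
  coordinate to be the negative of another one around a cycle of length three. The plus sign would make the
  square root rational.\<close>

lemma sqrt13_notin_K13: "complex_of_real (sqrt 13) \<notin> K13"
proof
  let ?s = "complex_of_real (sqrt 13)"
  assume s: "?s \<in> K13"
  have sq: "?s * ?s = 13" by (simp flip: of_real_mult)
  have "13 = period_comb (- 13) (- 13) (- 13)" by (simp add: period_comb_diag)
  then have "period_shift 13 = 13" by (metis period_shift_period_comb)
  then have "period_shift ?s * period_shift ?s = ?s * ?s"
    using period_shift_mult[OF s s] sq by simp
  then consider "period_shift ?s = ?s" | "period_shift ?s = - ?s"
    by (auto simp: square_eq_iff)
  then have "period_shift ?s = ?s"
  proof cases
    case 2
    obtain a b c where abc: "?s = period_comb a b c" using s by (rule K13_cases)
    from 2 have "c = - a" "a = - b" "b = - c"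
      unfolding abc period_shift_period_comb period_comb_minus period_comb_inject by blast+
    then have "a = 0" "b = 0" "c = 0"
      by linarith+
    then show ?thesis by (simp add: abc)
  qed
  then have "?s \<in> \<rat>" by (rule period_shift_fixed[OF s])
  then show False
    using sqrt_13_irrational by simp
qed

lemma (in group) generate_order_3:
  assumes s: "s \<in> carrier G" and cube: "s \<otimes> s \<otimes> s = \<one>"
  shows "generate G {s} = {\<one>, s, s \<otimes> s}"
proof
  have inv: "inv s = s \<otimes> s" "inv (s \<otimes> s) = s"
    using s cube by (auto intro!: inv_equality simp: m_assoc)
  have "subgroup {\<one>, s, s \<otimes> s} G"
  proof (rule subgroupI)
    fix a b assume "a \<in> {\<one>, s, s \<otimes> s}" "b \<in> {\<one>, s, s \<otimes> s}"
    moreover have "s \<otimes> (s \<otimes> s) = \<one>" "s \<otimes> s \<otimes> (s \<otimes> s) = s"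
      using s cube by (simp_all flip: m_assoc)
    ultimately show "a \<otimes> b \<in> {\<one>, s, s \<otimes> s}"
      using s cube by auto
  qed (use s inv in auto)
  then show "generate G {s} \<subseteq> {\<one>, s, s \<otimes> s}"
    by (intro generate_subgroup_incl) auto
  show "{\<one>, s, s \<otimes> s} \<subseteq> generate G {s}"
    by (auto intro: generate.intros)
qed

lemma carrier_Gal_iff:
  "\<sigma> \<in> carrier (Gal F L) \<longleftrightarrow>
     \<sigma> \<in> extensional L \<and> bij_betw \<sigma> L L \<and> \<sigma> 1 = 1 \<and> (\<forall>x\<in>F. \<sigma> x = x) \<and>
     (\<forall>x\<in>L. \<forall>y\<in>L. \<sigma> (x * y) = \<sigma> x * \<sigma> y \<and> \<sigma> (x + y) = \<sigma> x + \<sigma> y)"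
  by (auto simp: Gal_def Bij_def ring_hom_def CC_simps bij_betw_imp_funcset[THEN funcset_mem])

lemma period_shift_Gal: "period_shift \<in> carrier (Gal \<rat> K13)"
  unfolding carrier_Gal_iff
proof (intro conjI ballI)
  have "period_shift (period_shift (period_shift x)) = x" if "x \<in> K13" for x
    using that by (auto elim!: K13_cases)
  moreover have "period_shift x \<in> K13" if "x \<in> K13" for x
    using that by (auto elim!: K13_cases)
  ultimately show "bij_betw period_shift K13 K13"
    by (intro bij_betw_byWitness[where f' = "\<lambda>x. period_shift (period_shift x)"]) auto
  show rat: "period_shift x = x" if "x \<in> \<rat>" for x
    using that by (auto elim!: Rats_cases simp flip: period_comb_diag)
  show "period_shift 1 = 1" by (rule rat) simp
  show "period_shift \<in> extensional K13" by (rule period_shift_extensional)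
  fix x y assume xy: "x \<in> K13" "y \<in> K13"
  then show "period_shift (x * y) = period_shift x * period_shift y" by (rule period_shift_mult)
  from xy obtain a b c a' b' c' where "x = period_comb a b c" "y = period_comb a' b' c'"
    by (metis K13_cases)
  then show "period_shift (x + y) = period_shift x + period_shift y"
    by (simp only: period_comb_add period_shift_period_comb)
qed

lemma period_shift_compose_Gal: "compose K13 period_shift period_shift \<in> carrier (Gal \<rat> K13)"
proof -
  have "period_shift x \<in> K13" if "x \<in> K13" for x
    using that by (auto elim!: K13_cases)
  then show ?thesis
    using period_shift_Gal subfield_CC_closed[OF subfield_K13] Rats_subset_subfield_CC[OF subfield_K13]
    unfolding carrier_Gal_iff
    by (auto simp: bij_betw_compose compose_eq subset_iff)
qed

text \<open>The other two periods are polynomials in \<open>eta0\<close>, so an automorphism is known once its value \<open>y\<close> at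
  \<open>eta0\<close> is. Applying it to \<open>eta0 * eta1 = eta1 - 1\<close> gives a monic cubic equation for \<open>y\<close> whose roots are
  the three periods.\<close>

lemma Gal_K13_cases:
  assumes "\<tau> \<in> carrier (Gal \<rat> K13)"
  shows "\<tau> = (\<lambda>x\<in>K13. x) \<or> \<tau> = period_shift \<or> \<tau> = compose K13 period_shift period_shift"
proof -
  note cl = subfield_CC_closed[OF subfield_K13] subfield_CC_of_rat[OF subfield_K13] eta_in_K13
    subfield_CC_numeral[OF subfield_K13]
  have ext: "\<tau> \<in> extensional K13"
    using assms unfolding carrier_Gal_iff by blast
  have fix_rat: "\<tau> x = x" if "x \<in> \<rat>" for x
    using assms that unfolding carrier_Gal_iff by blast
  have mult: "\<tau> (x * y) = \<tau> x * \<tau> y" and add: "\<tau> (x + y) = \<tau> x + \<tau> y"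
    if "x \<in> K13" "y \<in> K13" for x y
    using assms that unfolding carrier_Gal_iff by blast+
  have coords: "\<tau> (period_comb a b c) = of_rat a * \<tau> eta0 + of_rat b * \<tau> eta1 + of_rat c * \<tau> eta2" for a b c
    unfolding period_comb_def by (simp add: add mult cl fix_rat)
  have e2: "eta2 = - 1 - eta0 - eta1"
    using eta_sum by (simp add: algebra_simps)
  define y where "y = \<tau> eta0"
  have "eta0 * eta0 + eta1 + 2 * eta0 = 2"
    by (subst eta1_poly) (simp add: power2_eq_square)
  then have "\<tau> (eta0 * eta0 + eta1 + 2 * eta0) = \<tau> 2"
    by (rule arg_cong)
  then have t1: "\<tau> eta1 = 2 - 2 * y - y\<^sup>2"
    by (simp add: add mult cl fix_rat y_def power2_eq_square algebra_simps)
  have "\<tau> (eta0 + eta1 + eta2 + 1) = \<tau> 0"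
    using eta_sum by (intro arg_cong[where f = \<tau>]) simp
  then have t2: "\<tau> eta2 = - 1 - y - \<tau> eta1"
    by (simp add: add mult cl fix_rat y_def algebra_simps add_eq_0_iff)
  have "\<tau> (eta0 * eta1 + 1) = \<tau> eta1"
    using eta_mult(1) by (intro arg_cong[where f = \<tau>]) simp
  then have "y * \<tau> eta1 + 1 = \<tau> eta1"
    by (simp add: add mult cl fix_rat y_def)
  then have "(y - eta0) * (y - eta1) * (y - eta2) = 0"
  proof -
    have "(y - eta0) * (y - eta1) * (y - eta2) =
        y ^ 3 - (eta0 + eta1 + eta2) * y\<^sup>2 + (eta0 * eta1 + eta1 * eta2 + eta2 * eta0) * y
        - eta0 * (eta1 * eta2)"
      by (simp add: algebra_simps power2_eq_square power3_eq_cube)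
    also have "eta0 * (eta1 * eta2) = - 1"
      using eta_mult(3) unfolding eta_mult(2) by (simp add: algebra_simps)
    also have "eta0 * eta1 + eta1 * eta2 + eta2 * eta0 = - 4"
      using eta_sum unfolding eta_mult by (simp add: algebra_simps)
    finally show ?thesis
      using \<open>y * \<tau> eta1 + 1 = \<tau> eta1\<close> unfolding t1 eta_sum
      by (simp add: algebra_simps power2_eq_square power3_eq_cube)
  qed
  then consider "y = eta0" | "y = eta1" | "y = eta2" by auto
  then show ?thesis
  proof cases
    case 1
    have "\<tau> eta1 = eta1" "\<tau> eta2 = eta2"
      unfolding t2 t1 1 eta_square by (simp_all add: e2)
    then have "\<tau> = (\<lambda>x\<in>K13. x)"
      using 1 by (intro extensionalityI[OF ext restrict_extensional])
         (auto elim!: K13_cases simp: coords y_def, simp add: period_comb_def)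
    then show ?thesis by blast
  next
    case 2
    have "\<tau> eta1 = eta2" "\<tau> eta2 = eta0"
      unfolding t2 t1 2 eta_square by (simp_all add: e2)
    then have "\<tau> = period_shift"
      using 2 by (intro extensionalityI[OF ext period_shift_extensional])
         (auto elim!: K13_cases simp: coords y_def, simp add: period_comb_def)
    then show ?thesis by blast
  next
    case 3
    have "\<tau> eta1 = eta0" "\<tau> eta2 = eta1"
      unfolding t2 t1 3 eta_square by (simp_all add: e2)
    then have "\<tau> = compose K13 period_shift period_shift"
      using 3 by (intro extensionalityI[OF ext compose_extensional])
         (auto elim!: K13_cases simp: coords y_def compose_eq, simp add: period_comb_def)
    then show ?thesis by blast
  qed
qed

text \<open>The Galois group is the subgroup generated by the shift inside the group of all bijections of \<open>K13\<close>,
  so that it is a group and cyclic by the same argument.\<close>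

lemma cyclic_group_Gal_K13: "cyclic_group (Gal \<rat> K13)"
proof -
  let ?B = "BijGroup K13"
  interpret B: group ?B by (rule group_BijGroup)
  have Bij: "period_shift \<in> Bij K13" "compose K13 period_shift period_shift \<in> Bij K13"
    using period_shift_Gal period_shift_compose_Gal by (auto simp: Gal_def)
  have one: "\<one>\<^bsub>?B\<^esub> = (\<lambda>x\<in>K13. x)" and sq: "period_shift \<otimes>\<^bsub>?B\<^esub> period_shift = compose K13 period_shift period_shift"
    using Bij by (simp_all add: BijGroup_def)
  have carrier: "period_shift \<in> carrier ?B"
    using Bij by (simp add: BijGroup_def)
  have "compose K13 (compose K13 period_shift period_shift) period_shift = (\<lambda>x\<in>K13. x)"
    by (rule extensionalityI[OF compose_extensional restrict_extensional]) (auto elim!: K13_cases simp: compose_eq)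
  then have cube: "period_shift \<otimes>\<^bsub>?B\<^esub> period_shift \<otimes>\<^bsub>?B\<^esub> period_shift = \<one>\<^bsub>?B\<^esub>"
    using Bij unfolding one sq by (simp add: BijGroup_def)
  have id: "(\<lambda>x\<in>K13. x) \<in> carrier (Gal \<rat> K13)"
    using subfield_CC_closed[OF subfield_K13] Rats_subset_subfield_CC[OF subfield_K13]
    unfolding carrier_Gal_iff by (auto simp: subset_iff bij_betw_def inj_on_def)
  have "generate ?B {period_shift} = carrier (Gal \<rat> K13)"
    unfolding B.generate_order_3[OF carrier cube] one sq
    using id period_shift_Gal period_shift_compose_Gal Gal_K13_cases by blast
  then have "subgroup_generated ?B {period_shift} = Gal \<rat> K13"
    using carrier by (simp add: subgroup_generated_def Gal_def)
  then show ?thesis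
    using B.cyclic_group_generated[of period_shift] by simp
qed

lemma cyclic_cubic_extension_K13: "cyclic_cubic_extension \<rat> K13"
proof -
  interpret Ring.field CC by (rule field_CC)
  have ext: "field_extension \<rat> K13"
    unfolding field_extension_def
    using subfield_Rats subfield_K13 Rats_subset_subfield_CC[OF subfield_K13] by blast
  have "{x \<in> K13. \<forall>\<sigma>\<in>carrier (Gal \<rat> K13). \<sigma> x = x} = \<rat>"
  proof (intro equalityI subsetI)
    fix x assume "x \<in> {x \<in> K13. \<forall>\<sigma>\<in>carrier (Gal \<rat> K13). \<sigma> x = x}"
    then show "x \<in> \<rat>"
      using period_shift_Gal period_shift_fixed by blast
  next
    fix x :: complex assume x: "x \<in> \<rat>"
    moreover have "\<sigma> x = x" if "\<sigma> \<in> carrier (Gal \<rat> K13)" for \<sigma>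
      using that x unfolding carrier_Gal_iff by blast
    ultimately show "x \<in> {x \<in> K13. \<forall>\<sigma>\<in>carrier (Gal \<rat> K13). \<sigma> x = x}"
      using Rats_subset_subfield_CC[OF subfield_K13] by blast
  qed
  then show ?thesis
    unfolding cyclic_cubic_extension_def cyclic_extension_def finite_galois_extension_def
      finite_dimension_def
    using ext dimension_K13 cyclic_group_Gal_K13 by (intro conjI exI)
qed

section \<open>The maximal real subfield\<close>

abbreviation L13 :: "complex set" where
  "L13 \<equiv> adjoin K13 {complex_of_real (sqrt 13)}"

lemma gauss_sum_mem_iff:
  assumes "subfield F CC"
  shows "gauss_sum \<in> F \<longleftrightarrow> complex_of_real (sqrt 13) \<in> F"
  using gauss_sum_cases subfield_CC_closed(4)[OF assms] by (metis minus_minus)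

lemma zeta_tr_real: "zeta_tr k \<in> \<real>"
  by (simp add: zeta_tr_def Reals_cnj_iff cnj_zeta power_int_minus power_int_inverse)

lemma zeta_tr_in_adjoin_zeta: "zeta_tr k \<in> adjoin \<rat> {zeta}"
proof -
  have "zeta \<in> adjoin \<rat> {zeta}" using adjoin_gens by blast
  then show ?thesis
    unfolding zeta_tr_def
    by (intro subfield_CC_closed subfield_CC_powi subfield_adjoin)
qed

lemma K13_real: "K13 \<subseteq> \<real>"
  unfolding K13_def
  by (rule adjoin_least[OF subfield_Reals Rats_subset_subfield_CC[OF subfield_Reals]])
     (simp add: eta_zeta_tr zeta_tr_real)

lemma K13_subset_adjoin_zeta: "K13 \<subseteq> adjoin \<rat> {zeta}"
  unfolding K13_def
  by (rule adjoin_least[OF subfield_adjoin adjoin_base])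
     (simp add: eta_zeta_tr zeta_tr_in_adjoin_zeta subfield_CC_closed[OF subfield_adjoin])

lemma L13_real: "L13 \<subseteq> \<real>"
  by (rule adjoin_least[OF subfield_Reals K13_real]) simp

lemma L13_subset_adjoin_zeta: "L13 \<subseteq> adjoin \<rat> {zeta}"
proof (rule adjoin_least[OF subfield_adjoin K13_subset_adjoin_zeta])
  note cl = subfield_CC_closed[OF subfield_adjoin]
  have "gauss_sum \<in> adjoin \<rat> {zeta}"
    unfolding gauss_sum_def by (intro cl zeta_tr_in_adjoin_zeta)
  then show "{complex_of_real (sqrt 13)} \<subseteq> adjoin \<rat> {zeta}"
    by (simp add: gauss_sum_mem_iff[OF subfield_adjoin])
qed

text \<open>The sum of \<open>zeta_tr 1\<close> and \<open>zeta_tr 5\<close> is \<open>eta0\<close>, and their difference is the combination of periods in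
  \<open>gauss_sum_mult_diff\<close> divided by the Gauss sum, that is, multiplied by a thirteenth of it.\<close>

lemma zeta_tr_1_in_L13: "zeta_tr 1 \<in> L13"
proof -
  note cl = subfield_CC_closed[OF subfield_adjoin] subfield_CC_numeral[OF subfield_adjoin]
  have gs: "gauss_sum \<in> L13"
    unfolding gauss_sum_mem_iff[OF subfield_adjoin] using adjoin_gens by blast
  have eta: "eta0 \<in> L13" "eta1 \<in> L13" "eta2 \<in> L13"
    using eta_in_K13 adjoin_base by blast+
  have "gauss_sum * (4 - eta0 + 2 * eta1 - 2 * eta2) = gauss_sum\<^sup>2 * (zeta_tr 1 - zeta_tr 5)"
    by (simp flip: gauss_sum_mult_diff add: power2_eq_square)
  then have "zeta_tr 1 = (eta0 + gauss_sum * (4 - eta0 + 2 * eta1 - 2 * eta2) / 13) / 2"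
    by (simp add: gauss_sum_square eta_zeta_tr)
  then show ?thesis
    by (simp only:) (intro cl gs eta)
qed

lemma zeta_square: "zeta * zeta = zeta_tr 1 * zeta - 1"
proof -
  have "zeta_tr 1 = zeta + inverse zeta"
    by (simp add: zeta_tr_def power_int_minus)
  then show ?thesis
    by (simp add: distrib_right)
qed

text \<open>By \<open>zeta_square\<close> the set is closed under products. As \<open>a\<close> and \<open>b\<close> are real, the complex conjugate of
  \<open>a + b * zeta\<close> is \<open>a + b * inverse zeta\<close>, which is again in the set, and their product lies in \<open>L13\<close>;
  this yields inverses.\<close>

lemma subfield_L13_zeta: "subfield {a + b * zeta | a b. a \<in> L13 \<and> b \<in> L13} CC"
  (is "subfield ?M CC")
proof (rule subfield_CC_I)
  note cl = subfield_CC_closed[OF subfield_adjoin]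
  have M: "a + b * zeta \<in> ?M" if "a \<in> L13" "b \<in> L13" for a b
    using that by blast
  show "1 \<in> ?M"
    using M[of 1 0] by (simp add: cl)
  fix x assume "x \<in> ?M"
  then obtain a b where x: "x = a + b * zeta" and ab: "a \<in> L13" "b \<in> L13"
    by blast
  show "- x \<in> ?M"
    using M[of "- a" "- b"] ab by (simp add: x cl)
  {
    fix y assume "y \<in> ?M"
    then obtain c d where y: "y = c + d * zeta" and cd: "c \<in> L13" "d \<in> L13"
      by blast
    have "x + y = (a + c) + (b + d) * zeta"
      by (simp add: x y algebra_simps)
    then show "x + y \<in> ?M"
      using M ab cd by (simp add: cl)
    have "x * y = (a * c - b * d) + (a * d + b * c + b * d * zeta_tr 1) * zeta"
    proof -
      have "x * y = a * c + (a * d + b * c) * zeta + b * d * (zeta * zeta)"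
        by (simp add: x y algebra_simps)
      then show ?thesis
        unfolding zeta_square by (simp add: algebra_simps)
    qed
    also have "\<dots> \<in> ?M"
      by (intro M cl ab cd zeta_tr_1_in_L13)
    finally show "x * y \<in> ?M" .
  }
  assume "x \<noteq> 0"
  define n where "n = a * a + a * b * zeta_tr 1 + b * b"
  have conj: "cnj x = a + b * (zeta_tr 1 - zeta)"
  proof -
    have "cnj a = a" "cnj b = b"
      using ab L13_real by (auto simp: Reals_cnj_iff)
    then show ?thesis by (simp add: x cnj_zeta zeta_tr_def)
  qed
  have n: "x * cnj x = n"
  proof -
    have "x * cnj x = a * a + a * b * zeta_tr 1 + b * b * (zeta_tr 1 * zeta - zeta * zeta)"
      unfolding conj by (simp add: x algebra_simps)
    then show ?thesis
      unfolding zeta_square n_def by simp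
  qed
  then have "inverse x = cnj x / n"
    using \<open>x \<noteq> 0\<close> by (auto simp: field_simps)
  also have "\<dots> = (a + b * zeta_tr 1) / n + (- b / n) * zeta"
    by (simp add: conj algebra_simps add_divide_distrib diff_divide_distrib)
  also have "\<dots> \<in> ?M"
    unfolding n_def by (intro M cl ab zeta_tr_1_in_L13)
  finally show "inverse x \<in> ?M" .
qed

lemma adjoin_zeta_real_subset: "adjoin \<rat> {zeta} \<inter> \<real> \<subseteq> L13"
proof
  fix x assume x: "x \<in> adjoin \<rat> {zeta} \<inter> \<real>"
  note cl = subfield_CC_closed[OF subfield_adjoin]
  have "zeta \<in> {a + b * zeta | a b. a \<in> L13 \<and> b \<in> L13}"
  proof -
    have "zeta = 0 + 1 * zeta" "0 \<in> L13" "1 \<in> L13"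
      by (simp_all only: cl mult_1 add_0)
    then show ?thesis by blast
  qed
  then have "adjoin \<rat> {zeta} \<subseteq> {a + b * zeta | a b. a \<in> L13 \<and> b \<in> L13}"
    by (intro adjoin_least[OF subfield_L13_zeta Rats_subset_subfield_CC[OF subfield_L13_zeta]])
       simp
  with x obtain a b where ab: "x = a + b * zeta" "a \<in> L13" "b \<in> L13"
    by blast
  then have "a \<in> \<real>" "b \<in> \<real>"
    using L13_real by auto
  then have "Im x = Re b * Im zeta"
    by (simp add: ab complex_is_Real_iff)
  then have "Re b = 0"
    using x Im_zeta by (simp add: complex_is_Real_iff)
  then have "b = 0"
    using \<open>b \<in> \<real>\<close> by (simp add: complex_eq_iff complex_is_Real_iff)
  then show "x \<in> L13"
    using ab by simp
qed

lemma L13_eq: "L13 = maximal_real_subfield (adjoin \<rat> {zeta})"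
  using adjoin_zeta_real_subset L13_subset_adjoin_zeta L13_real
  by (auto simp: maximal_real_subfield_eq[OF subfield_adjoin])

section \<open>The projective transformation\<close>

definition T13 :: "complex^2^2" where
  "T13 = vector [vector [gamma, beta], vector [alpha, - gamma]]"

lemma entries_T13:
  "T13 $ 1 $ 1 = gamma" "T13 $ 1 $ 2 = beta" "T13 $ 2 $ 1 = alpha" "T13 $ 2 $ 2 = - gamma"
  by (simp_all add: T13_def)

lemma sqrt13_S13: "sqrt 13 *\<^sub>R S13 = T13"
  by (simp add: S13_def T13_def)

lemma S13_entry: "S13 $ i $ j = T13 $ i $ j / complex_of_real (sqrt 13)"
  by (simp add: S13_def T13_def scaleR_conv_of_real[where 'a = complex])

lemma T13_in_K13: "T13 $ i $ j \<in> K13"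
proof -
  have "gamma \<in> K13" "beta \<in> K13" "alpha \<in> K13"
    unfolding gamma_def beta_def alpha_def
    by (intro subfield_CC_closed[OF subfield_K13] eta_in_K13)+
  then show ?thesis
    using exhaust_2[of i] exhaust_2[of j] subfield_CC_closed(4)[OF subfield_K13, of gamma]
    by (auto simp: entries_T13)
qed

text \<open>The left-hand side is minus the determinant of \<open>T13\<close>; in terms of the periods it is the symmetric
  expression \<open>(eta0 + eta1 + eta2)\<^sup>2 - 3 * (eta0 * eta1 + eta1 * eta2 + eta2 * eta0)\<close>, that is, 1 + 12.\<close>

lemma gamma_square_add: "gamma * gamma + alpha * beta = 13"
proof -
  have "gamma * gamma + alpha * beta =
      (eta0\<^sup>2 + eta1\<^sup>2 + eta2\<^sup>2) - (eta0 * eta1 + eta1 * eta2 + eta2 * eta0)"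
    by (simp add: gamma_def alpha_def beta_def algebra_simps power2_eq_square)
  also have "\<dots> = 15 + 2 * (eta0 + eta1 + eta2)"
    unfolding eta_square eta_mult by simp
  finally show ?thesis
    unfolding eta_sum by simp
qed

text \<open>By Cayley-Hamilton, since the trace of \<open>T13\<close> is zero and its determinant is -13.\<close>

lemma T13_square: "T13 ** T13 = 13 *\<^sub>R mat 1"
  using gamma_square_add
  by (simp add: vec_eq_iff forall_2 matrix_matrix_mult_def sum_2 entries_T13 mat_def
      scaleR_conv_of_real[where 'a = complex] algebra_simps)

text \<open>A line is mapped to itself by multiplication with a nonzero scalar.\<close>

lemma projective_map_scaleR:
  assumes "c \<noteq> 0"
  shows "projective_map (c *\<^sub>R A) = projective_map A"
proof -
  have "(\<lambda>v. (c *\<^sub>R A) *v v) ` P = (\<lambda>v. A *v v) ` P" if line: "P \<in> projective_line" for P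
  proof -
    obtain u where P: "P = vec.span {u}"
      using line unfolding projective_line_def by blast
    have mem: "of_real d *s v \<in> P" if "v \<in> P" for d v
      using that unfolding P by (rule vec.span_scale)
    have eq: "(c *\<^sub>R A) *v v = A *v (of_real c *s v)" for v
      by (simp add: vec_eq_iff matrix_vector_mult_def scaleR_conv_of_real[where 'a = complex]
          sum_distrib_left mult_ac)
    have inv: "A *v v = (c *\<^sub>R A) *v (of_real (1 / c) *s v)" for v
      using assms unfolding eq by (simp add: vector_smult_assoc del: of_real_divide flip: of_real_mult)
    show ?thesis
    proof (intro equalityI image_subsetI)
      fix v assume "v \<in> P"
      then show "(c *\<^sub>R A) *v v \<in> (\<lambda>v. A *v v) ` P"
        unfolding eq by (intro imageI mem)
      show "A *v v \<in> (\<lambda>v. (c *\<^sub>R A) *v v) ` P"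
        unfolding inv using \<open>v \<in> P\<close> by (intro imageI mem)
    qed
  qed
  then show ?thesis
    unfolding projective_map_def by (intro restrict_ext) blast
qed

lemma T13_GL2: "T13 \<in> GL2 K13"
proof -
  let ?N = "(1 / 13) *\<^sub>R T13"
  have "T13 ** ?N = mat 1" "?N ** T13 = mat 1"
    using T13_square by (simp_all add: matrix_scalar_ac scalar_matrix_assoc flip: scalar_matrix_assoc)
  moreover have "?N $ i $ j \<in> K13" for i j
    using subfield_CC_closed(8)[OF subfield_K13 T13_in_K13 subfield_CC_numeral[OF subfield_K13], of i j]
    by (simp add: scaleR_conv_of_real[where 'a = complex])
  ultimately show ?thesis
    unfolding GL2_def using T13_in_K13 by blast
qed

lemma S13_defined_over_K13: "projective_map_defined_over S13 K13"
proof -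
  have "S13 = (1 / sqrt 13) *\<^sub>R T13"
    by (simp add: S13_def T13_def)
  then have map: "projective_map T13 = projective_map S13"
    using projective_map_scaleR[of "1 / sqrt 13" T13] by simp
  have "S13 ** S13 = mat 1"
    using gamma_square_add
    by (simp add: vec_eq_iff forall_2 matrix_matrix_mult_def sum_2 S13_entry entries_T13 mat_def
        add.commute mult.commute flip: add_divide_distrib of_real_mult)
  then have "invertible S13"
    unfolding invertible_def by blast
  with map T13_GL2 show ?thesis
    unfolding projective_map_defined_over_def by blast
qed

theorem mainTheorem2:
  "cyclic_cubic_extension \<rat> K13
   \<and> (\<forall>i j. (sqrt 13 *\<^sub>R S13) $ i $ j \<in> K13)
   \<and> projective_map_defined_over S13 K13
   \<and> (\<forall>i j. S13 $ i $ j \<noteq> 0 \<longrightarrow> S13 $ i $ j \<notin> K13)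
   \<and> (\<forall>i j. S13 $ i $ j \<in> adjoin K13 {complex_of_real (sqrt 13)})
   \<and> adjoin K13 {complex_of_real (sqrt 13)} = maximal_real_subfield (adjoin \<rat> {zeta})"
proof (intro conjI allI impI)
  fix i j
  show "S13 $ i $ j \<notin> K13" if nz: "S13 $ i $ j \<noteq> 0"
  proof
    assume "S13 $ i $ j \<in> K13"
    then have "T13 $ i $ j / S13 $ i $ j \<in> K13"
      by (intro subfield_CC_closed[OF subfield_K13] T13_in_K13)
    moreover have "T13 $ i $ j / S13 $ i $ j = complex_of_real (sqrt 13)"
      using nz by (simp add: S13_entry)
    ultimately show False
      using sqrt13_notin_K13 by simp
  qed
  have "T13 $ i $ j \<in> L13"
    using T13_in_K13 adjoin_base by blast
  moreover have "complex_of_real (sqrt 13) \<in> L13"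
    using adjoin_gens by blast
  ultimately show "S13 $ i $ j \<in> L13"
    unfolding S13_entry by (rule subfield_CC_closed(8)[OF subfield_adjoin])
qed (simp_all add: cyclic_cubic_extension_K13 sqrt13_S13 T13_in_K13 S13_defined_over_K13 L13_eq)

end
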